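(* Let $k\ge1$ and let $\lambda$ be a $k$-bounded partition with residue table $R=(r_{ij})$ and quotient table $Q=(q_{ij})$. Then $$|\mathfrak c^{(k)}(\lambda)|-|\lambda|=\sum_{1\le i\le j\le k} r_{ij}q_{ij}+\sum_{1\le i\le j<h\le k} r_{hh}q_{ij}+\sum_{1\le i\le j\le h\le k}(k+1-h)q_{hh}q_{ij}-\sum_{1\le i\le k} i(k+1-i)\binom{q_{ii}+1}{2}.$$
   Context: A partition is a weakly decreasing finite sequence of positive integers; $|\lambda|$ is the sum of its parts and $m_j(\lambda)$ the number of parts equal to $j$; $\lambda$ is $k$-bounded if all parts are at most $k$. Hook length of cell $(i,j)$ of $\pi$ is $\pi_i+\pi'_j-i-j+1$. For a $k$-bounded $\lambda$, $\mathfrak c^{(k)}(\lambda)$ is the $(k+1)$-core (partition with no hook length equal to $k+1$) obtained by processing rows of the diagram of $\lambda$ from the last row upward, shifting the $\lambda_i$ cells of row $i$ to the right until all their hook lengths are at most $k$. The residue table $(r_{ij})_{1\le i\le j\le k}$: $r_{ii}=m_i(\lambda)\bmod(k+1-i)$, $r_{ij}=(m_j(\lambda)+r_{i,j-1})\bmod(k+1-j)$ for $i<j$. The quotient table: $q_{ii}=\lfloor m_i(\lambda)/(k+1-i)\rfloor$, $q_{ij}=\lfloor (m_j(\lambda)+r_{i,j-1})/(k+1-j)\rfloor$ for $i<j$. *)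

theory Defs
  imports Main
begin

text \<open>
  A partition is the list of its parts, first part at list index 0. Rows, columns and
  the indices of the residue and quotient tables are numbered from 1.
\<close>

definition is_partition :: "nat list \<Rightarrow> bool" where
  "is_partition p \<longleftrightarrow> sorted_wrt (\<ge>) p \<and> 0 \<notin> set p"

definition bounded_partition :: "nat \<Rightarrow> nat list \<Rightarrow> bool" where
  "bounded_partition k p \<longleftrightarrow> is_partition p \<and> (\<forall>a \<in> set p. a \<le> k)"

definition row_length :: "nat list \<Rightarrow> nat \<Rightarrow> nat" where
  "row_length p i = p ! (i - 1)"

definition column_length :: "nat list \<Rightarrow> nat \<Rightarrow> nat" where
  "column_length p j = length (filter (\<lambda>a. j \<le> a) p)"

text \<open>Integer-valued, so that the subtractions are not truncated.\<close>

definition hook_length :: "nat list \<Rightarrow> nat \<Rightarrow> nat \<Rightarrow> int" where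
  "hook_length p i j = int (row_length p i) + int (column_length p j) - int i - int j + 1"

text \<open>
  The rows are processed from the last one upward. When the row of length \<open>a\<close> is reached,
  \<open>p\<close> is the shape formed by the rows below it. If the row is moved \<open>s\<close> steps to the
  right, its cells occupy columns \<open>s + 1, \<dots>, s + a\<close>, and \<open>s\<close> is the first shift for which
  all of these cells have hook length at most \<open>k\<close>. The vacated positions to the left of
  the shifted row count as cells of the core, so the new row has length \<open>s + a\<close>. Hook
  lengths of the cells of a row do not depend on the rows above it.
\<close>

fun core_of :: "nat \<Rightarrow> nat list \<Rightarrow> nat list" where
  "core_of k [] = []"
| "core_of k (a # lam) =
     (let p = core_of k lam;
          s = (LEAST s. \<forall>j \<in> {s + 1..s + a}. hook_length ((s + a) # p) 1 j \<le> int k)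
      in (s + a) # p)"

text \<open>
  Only the entries with \<open>1 \<le> i \<le> j \<le> k\<close> are meaningful; below the diagonal both tables
  are set to 0.
\<close>

fun residue_table :: "nat \<Rightarrow> nat list \<Rightarrow> nat \<Rightarrow> nat \<Rightarrow> nat" where
  "residue_table k lam i j =
     (if i = j then count_list lam i mod (k + 1 - i)
      else if i < j then (count_list lam j + residue_table k lam i (j - 1)) mod (k + 1 - j)
      else 0)"

declare residue_table.simps [simp del]

definition quotient_table :: "nat \<Rightarrow> nat list \<Rightarrow> nat \<Rightarrow> nat \<Rightarrow> nat" where
  "quotient_table k lam i j =
     (if i = j then count_list lam i div (k + 1 - i)
      else if i < j then (count_list lam j + residue_table k lam i (j - 1)) div (k + 1 - j)
      else 0)"

end

theory Submission
  imports Defs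
begin

text \<open>
  Number the rows of \<open>\<lambda>\<close> from 0. The shift of row \<open>s\<close> is the length of row
  \<open>s + k + 1 - \<lambda>\<^sub>s\<close> of the core, so the core rows satisfy
  \<open>c\<^sub>s = \<lambda>\<^sub>s + c\<^bsub>s + k + 1 - \<lambda>\<^sub>s\<^esub>\<close>: each is a sum of \<open>\<lambda>\<close>-parts along a chain of jumps.
  Writing a part as the number of \<open>i\<close> with \<open>i \<le> \<lambda>\<^sub>s\<close> gives \<open>c\<^sub>s = \<Sum>\<^sub>i L\<^sub>i s\<close>, where \<open>L\<^sub>i s\<close> counts
  the elements of the chain from \<open>s\<close> that lie among the rows of length at least \<open>i\<close>.
  The level sets of \<open>L\<^sub>i\<close> are consecutive intervals of rows. Read from the bottom, exactly
  \<open>q\<^bsub>ij\<^esub>\<close> of them have size \<open>k + 1 - j\<close> and are completed in block \<open>j\<close>, which leaves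
  \<open>r\<^bsub>ij\<^esub>\<close> rows to be carried into block \<open>j + 1\<close>. Summing \<open>L\<^sub>i\<close> over its levels gives
  the formula, up to the fact that \<open>q\<^bsub>ij\<^esub>\<close> is \<open>q\<^bsub>jj\<^esub>\<close> or \<open>q\<^bsub>jj\<^esub> + 1\<close>.
\<close>

subsection \<open>Rows of the core\<close>

text \<open>Padding with 0 lets the recursion for the core rows hold at every index, also when a
  jump passes the last row.\<close>

definition part :: "nat list \<Rightarrow> nat \<Rightarrow> nat" where
  "part p n = (if n < length p then p ! n else 0)"

lemma part_simps [simp]:
  "part [] n = 0" "part (a # p) 0 = a" "part (a # p) (Suc n) = part p n"
  by (auto simp: part_def)

lemma part_antimono:
  assumes "sorted_wrt (\<ge>) p" "m \<le> n"
  shows "part p n \<le> part p m"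
  using assms by (cases "m = n") (auto simp: part_def sorted_wrt_iff_nth_less)

lemma column_length_simps [simp]:
  "column_length [] j = 0"
  "column_length (a # p) j = (if j \<le> a then 1 else 0) + column_length p j"
  by (auto simp: column_length_def)

lemma column_length_antimono: "i \<le> j \<Longrightarrow> column_length p j \<le> column_length p i"
  by (induction p) auto

lemma less_column_length_iff:
  assumes "sorted_wrt (\<ge>) p" "1 \<le> j"
  shows "n < column_length p j \<longleftrightarrow> j \<le> part p n"
  using assms(1)
proof (induction p arbitrary: n)
  case Nil
  then show ?case using assms(2) by simp
next
  case (Cons a p)
  have IH: "m < column_length p j \<longleftrightarrow> j \<le> part p m" for m
    using Cons by simp
  show ?case
  proof (cases "j \<le> a")
    case True
    then show ?thesis using IH by (cases n) auto
  next
    case False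
    have "part (a # p) n \<le> a"
      using part_antimono[OF Cons.prems, of 0 n] by simp
    moreover have "column_length p j = 0"
    proof (rule ccontr)
      assume "column_length p j \<noteq> 0"
      then have "j \<le> part (a # p) 1" using IH[of 0] by simp
      also have "\<dots> \<le> a" using part_antimono[OF Cons.prems, of 0 1] by simp
      finally show False using False by simp
    qed
    ultimately show ?thesis using False by simp
  qed
qed

lemma hook_length_first_row:
  assumes "j \<le> b"
  shows "hook_length (b # p) 1 j = int (b - j) + int (column_length p j) + 1"
  using assms by (simp add: hook_length_def row_length_def)

text \<open>The leftmost cell, in column \<open>s + 1\<close>, has the largest hook length of the
  row, namely \<open>a + column_length p (s + 1)\<close>. So the condition is
  \<open>column_length p (s + 1) \<le> k - a\<close>, which says that row \<open>k - a\<close> of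
  \<open>p\<close> has length at most \<open>s\<close>.\<close>

lemma least_shift:
  assumes "sorted_wrt (\<ge>) p" "1 \<le> a" "a \<le> k"
  shows "(LEAST s. \<forall>j \<in> {s + 1..s + a}. hook_length ((s + a) # p) 1 j \<le> int k) = part p (k - a)"
proof -
  have "(\<forall>j \<in> {s + 1..s + a}. hook_length ((s + a) # p) 1 j \<le> int k) \<longleftrightarrow> part p (k - a) \<le> s"
    (is "?all \<longleftrightarrow> _") for s
  proof -
    have leftmost: "part p (k - a) \<le> s \<longleftrightarrow> column_length p (s + 1) \<le> k - a"
      using less_column_length_iff[OF assms(1), of "s + 1" "k - a"] by auto
    show ?thesis
    proof
      assume ?all
      then have "hook_length ((s + a) # p) 1 (s + 1) \<le> int k" using assms(2) by auto
      then have "column_length p (s + 1) \<le> k - a"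
        using assms(2,3) by (subst (asm) hook_length_first_row) auto
      then show "part p (k - a) \<le> s" using leftmost by simp
    next
      assume *: "part p (k - a) \<le> s"
      show ?all
      proof
        fix j assume j: "j \<in> {s + 1..s + a}"
        have "column_length p j \<le> column_length p (s + 1)"
          by (rule column_length_antimono) (use j in auto)
        also have "\<dots> \<le> k - a" using leftmost * by simp
        finally show "hook_length ((s + a) # p) 1 j \<le> int k"
          using j assms(2,3) by (subst hook_length_first_row) auto
      qed
    qed
  qed
  then show ?thesis by (simp add: Least_equality)
qed

lemma bounded_partition_Cons:
  "bounded_partition k (a # lam) \<longleftrightarrow>
     1 \<le> a \<and> a \<le> k \<and> (\<forall>b \<in> set lam. b \<le> a) \<and> bounded_partition k lam"
  by (auto simp: bounded_partition_def is_partition_def)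

lemma core_of_Cons:
  assumes "sorted_wrt (\<ge>) (core_of k lam)" "1 \<le> a" "a \<le> k"
  shows "core_of k (a # lam) = (a + part (core_of k lam) (k - a)) # core_of k lam"
  using least_shift[OF assms] by (simp add: Let_def)

declare core_of.simps(2) [simp del]

lemma sorted_core_of:
  assumes "bounded_partition k lam"
  shows "sorted_wrt (\<ge>) (core_of k lam)"
  using assms
proof (induction lam)
  case Nil
  then show ?case by simp
next
  case (Cons a lam)
  let ?p = "core_of k lam"
  have a: "1 \<le> a" "a \<le> k" and le_a: "\<forall>b \<in> set lam. b \<le> a" and lam: "bounded_partition k lam"
    using Cons.prems by (auto simp: bounded_partition_Cons)
  note sorted = Cons.IH[OF lam]
  have "part ?p 0 \<le> a + part ?p (k - a)"
  proof (cases lam)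
    case Nil
    then show ?thesis by simp
  next
    case (Cons b lam')
    have b: "1 \<le> b" "b \<le> k" and lam': "bounded_partition k lam'"
      using lam by (auto simp: Cons bounded_partition_Cons)
    have "b \<le> a" using le_a Cons by simp
    have "sorted_wrt (\<ge>) (core_of k lam')"
      using sorted unfolding Cons by (auto simp: core_of.simps(2) Let_def)
    \<comment> \<open>The index gains a \<open>Suc\<close> because \<open>?p\<close> starts with the
      row of \<open>b\<close> itself; hence the shift of that row is read off below row
      \<open>k - a\<close>.\<close>
    from core_of_Cons[OF this b] have "part ?p 0 = b + part ?p (Suc (k - b))"
      by (simp add: Cons)
    also have "\<dots> \<le> a + part ?p (k - a)"
      using \<open>b \<le> a\<close> by (intro add_mono part_antimono[OF sorted]) auto
    finally show ?thesis .
  qed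
  moreover have "x \<le> part ?p 0" if x: "x \<in> set ?p" for x
  proof -
    obtain n where "n < length ?p" "x = ?p ! n" using x by (auto simp: in_set_conv_nth)
    then show ?thesis using part_antimono[OF sorted, of 0 n] by (simp add: part_def)
  qed
  ultimately show ?case
    using sorted by (subst core_of_Cons[OF sorted a]) (auto intro: order_trans)
qed

lemma length_core_of [simp]: "length (core_of k lam) = length lam"
  by (induction lam) (auto simp: core_of.simps(2) Let_def)

lemma part_core_of:
  assumes "bounded_partition k lam"
  shows "part (core_of k lam) s =
    part lam s + part (core_of k lam) (Suc (s + (k - part lam s)))"
  using assms
proof (induction lam arbitrary: s)
  case Nil
  then show ?case by simp
next
  case (Cons a lam)
  have a: "1 \<le> a" "a \<le> k" and lam: "bounded_partition k lam"
    using Cons.prems by (auto simp: bounded_partition_Cons)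
  note core = core_of_Cons[OF sorted_core_of[OF lam] a]
  show ?case
  proof (cases s)
    case 0
    then show ?thesis by (simp add: core)
  next
    case (Suc n)
    then show ?thesis unfolding core using Cons.IH[OF lam, of n] by simp
  qed
qed

lemma sum_list_conv_part: "sum_list p = (\<Sum>s<length p. part p s)"
  by (simp add: part_def sum_list_sum_nth atLeast0LessThan)


subsection \<open>Chains of jumps\<close>

text \<open>With \<open>d s = k - part lam s\<close> the jump from \<open>s\<close> leads to the
  core row whose length is the shift of row \<open>s\<close>. The \<open>Suc\<close> makes every
  jump strictly forward, so the recursion terminates for any \<open>d\<close>.\<close>

function chain_length :: "(nat \<Rightarrow> nat) \<Rightarrow> nat \<Rightarrow> nat \<Rightarrow> nat" where
  "chain_length d B s = (if s < B then Suc (chain_length d B (Suc (s + d s))) else 0)"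
  by auto
termination by (relation "measure (\<lambda>(d, B, s). B - s)") auto

declare chain_length.simps [simp del]

lemma chain_length_eq_0: "B \<le> s \<Longrightarrow> chain_length d B s = 0"
  by (subst chain_length.simps) simp

text \<open>The rows from \<open>B'\<close> to \<open>B - 1\<close> are exactly those below
  \<open>B\<close> whose jump leaves the range below \<open>B\<close>. Hence a chain starting below
  \<open>B\<close> has exactly one element among them, its last one below \<open>B\<close>.\<close>

lemma chain_length_shrink:
  assumes "B' \<le> B" and inside: "\<And>s. Suc (s + d s) < B \<longleftrightarrow> s < B'"
  shows "chain_length d B s = (if s < B then 1 else 0) + chain_length d B' s"
proof (induction "B - s" arbitrary: s rule: less_induct)
  case less
  show ?case
  proof (cases "s < B'")
    case True
    then have "Suc (s + d s) < B" using inside by simp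
    then show ?thesis
      using less[of "Suc (s + d s)"] True \<open>B' \<le> B\<close>
      by (subst (1 2) chain_length.simps) simp
  next
    case False
    then have "B \<le> Suc (s + d s)" using inside[of s] by simp
    then show ?thesis
      using False by (subst (1 2) chain_length.simps) (simp add: chain_length_eq_0)
  qed
qed

definition chain_sum :: "(nat \<Rightarrow> nat) \<Rightarrow> nat \<Rightarrow> nat" where
  "chain_sum d B = (\<Sum>s<B. chain_length d B s)"

lemma chain_sum_extend: "B \<le> n \<Longrightarrow> (\<Sum>s<n. chain_length d B s) = chain_sum d B"
  unfolding chain_sum_def
  by (rule sum.mono_neutral_right) (auto simp: chain_length_eq_0)

lemma chain_sum_shrink:
  assumes "B' \<le> B" and "\<And>s. Suc (s + d s) < B \<longleftrightarrow> s < B'"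
  shows "chain_sum d B = B + chain_sum d B'"
proof -
  have "chain_sum d B = (\<Sum>s<B. 1 + chain_length d B' s)"
    unfolding chain_sum_def by (rule sum.cong) (simp_all add: chain_length_shrink[OF assms])
  then show ?thesis by (simp only: sum.distrib chain_sum_extend[OF assms(1)]) simp
qed


subsection \<open>Grouping the rows of a partition\<close>

lemma column_length_rec:
  "column_length p j = count_list p j + column_length p (Suc j)"
  by (induction p) auto

lemma column_length_eq_sum:
  assumes "\<forall>a \<in> set p. a \<le> k"
  shows "column_length p j = (\<Sum>h = j..k. count_list p h)"
  using assms
proof (induction p)
  case (Cons a p)
  have "(\<Sum>h = j..k. count_list (a # p) h) =
      (\<Sum>h = j..k. (if h = a then 1 else 0) + count_list p h)"
    by (rule sum.cong) auto
  also have "\<dots> = (if j \<le> a then 1 else 0) + (\<Sum>h = j..k. count_list p h)"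
    using Cons.prems by (simp add: sum.distrib sum.delta)
  finally show ?case using Cons by simp
qed simp

lemma sum_column_length:
  assumes "\<forall>a \<in> set p. a \<le> k"
  shows "sum_list p = (\<Sum>i = 1..k. column_length p i)"
  using assms
proof (induction p)
  case (Cons a p)
  have "(\<Sum>i = 1..k. if i \<le> a then 1 else 0) = card ({1..k} \<inter> {i. i \<le> a})"
    by (simp add: sum.If_cases)
  also have "{1..k} \<inter> {i. i \<le> a} = {1..a}" using Cons.prems by auto
  finally show ?case using Cons by (simp add: sum.distrib)
qed simp

locale bounded_parts =
  fixes k :: nat and lam :: "nat list"
  assumes bounded: "bounded_partition k lam"
begin

abbreviation "rows \<equiv> column_length lam"
abbreviation "count \<equiv> count_list lam"
abbreviation "r \<equiv> residue_table k lam"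
abbreviation "q \<equiv> quotient_table k lam"
abbreviation "S \<equiv> chain_sum (\<lambda>s. k - part lam s)"

lemma parts_le: "\<forall>a \<in> set lam. a \<le> k"
  using bounded by (simp add: bounded_partition_def)

lemma less_rows_iff: "1 \<le> i \<Longrightarrow> s < rows i \<longleftrightarrow> i \<le> part lam s"
  using bounded less_column_length_iff
  by (auto simp: bounded_partition_def is_partition_def)

lemma part_le: "part lam s \<le> k"
  using parts_le by (auto simp: part_def)

lemma rows_le_length: "rows i \<le> length lam"
  by (simp add: column_length_def)

section \<open>Size of the core through chains and their levels\<close>

lemma part_core_eq_sum_chain_length:
  "part (core_of k lam) s = (\<Sum>i = 1..k. chain_length (\<lambda>s. k - part lam s) (rows i) s)"
proof (induction "length lam - s" arbitrary: s rule: less_induct)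
  case less
  let ?L = "chain_length (\<lambda>s. k - part lam s)"
  let ?t = "Suc (s + (k - part lam s))"
  show ?case
  proof (cases "s < length lam")
    case False
    then have "rows i \<le> s" for i using rows_le_length[of i] by simp
    then show ?thesis using False by (simp add: part_def chain_length_eq_0)
  next
    case True
    \<comment> \<open>If \<open>rows i \<le> s\<close>, both chain lengths vanish.\<close>
    have "?L (rows i) s = (if i \<le> part lam s then 1 else 0) + ?L (rows i) ?t" if "i \<in> {1..k}" for i
    proof (cases "s < rows i")
      case True
      then show ?thesis using less_rows_iff[of i s] that
        by (subst chain_length.simps) simp
    next
      case False
      then show ?thesis using less_rows_iff[of i s] that
        by (simp add: chain_length_eq_0)
    qed
    then have "(\<Sum>i = 1..k. ?L (rows i) s) =
        (\<Sum>i = 1..k. if i \<le> part lam s then 1 else 0) + (\<Sum>i = 1..k. ?L (rows i) ?t)"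
      by (simp add: sum.distrib)
    also have "(\<Sum>i = 1..k. if i \<le> part lam s then 1 else 0) = card ({1..k} \<inter> {i. i \<le> part lam s})"
      by (simp add: sum.If_cases)
    also have "{1..k} \<inter> {i. i \<le> part lam s} = {1..part lam s}" using part_le[of s] by auto
    also have "(\<Sum>i = 1..k. ?L (rows i) ?t) = part (core_of k lam) ?t"
      using less True by simp
    finally show ?thesis using part_core_of[OF bounded, of s] by simp
  qed
qed

lemma sum_core: "sum_list (core_of k lam) = (\<Sum>i = 1..k. S (rows i))"
proof -
  have "sum_list (core_of k lam) =
      (\<Sum>i = 1..k. \<Sum>s<length lam. chain_length (\<lambda>s. k - part lam s) (rows i) s)"
    unfolding sum_list_conv_part part_core_eq_sum_chain_length length_core_of by (rule sum.swap)
  then show ?thesis by (simp add: chain_sum_extend[OF rows_le_length])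
qed

text \<open>The lowest level consists of the bottom \<open>k + 1 - j\<close> rows: the hypotheses on \<open>x\<close> ensure that
  all these rows have length at most \<open>j\<close> and that the row above them has length at least \<open>j\<close>.\<close>

lemma chain_sum_remove_level:
  assumes j: "1 \<le> j" "j \<le> k" and x: "x \<le> count j"
  shows "S (rows (Suc j) + (x + (k + 1 - j))) =
    rows (Suc j) + (x + (k + 1 - j)) + S (rows (Suc j) + x)"
proof (rule chain_sum_shrink)
  fix s
  show "Suc (s + (k - part lam s)) < rows (Suc j) + (x + (k + 1 - j)) \<longleftrightarrow> s < rows (Suc j) + x"
  proof (cases "s < rows (Suc j) + x")
    case True
    then have "s < rows j" using x column_length_rec[of lam j] by simp
    \<comment> \<open>A part at least \<open>j\<close> jumps by at most \<open>k + 1 - j\<close>; in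
      the other case the part is at most \<open>j\<close> and jumps by at least that.\<close>
    then have "j \<le> part lam s" using less_rows_iff j by simp
    then show ?thesis using True j part_le[of s] by simp
  next
    case False
    then have "\<not> Suc j \<le> part lam s" using less_rows_iff[of "Suc j" s] by simp
    then show ?thesis using False j by simp
  qed
qed simp

text \<open>If removing the lowest level turns \<open>B\<close> into \<open>B'\<close>, then
  \<open>S B - B = S B' = B' + (S B' - B')\<close>. So \<open>n\<close> removals contribute the
  \<open>n\<close> remaining sizes, an arithmetic progression with difference
  \<open>k + 1 - j\<close>. The slack \<open>k + 1 - j\<close> in the hypothesis leaves room for
  rows carried in from the block below.\<close>

lemma chain_sum_remove_levels:
  assumes j: "1 \<le> j" "j \<le> k" and x: "x + n * (k + 1 - j) \<le> count j + (k + 1 - j)"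
  shows "int (S (rows (Suc j) + (x + n * (k + 1 - j)))) - int (rows (Suc j) + (x + n * (k + 1 - j)))
    = int (n * (rows (Suc j) + x) + (k + 1 - j) * (n choose 2))
      + (int (S (rows (Suc j) + x)) - int (rows (Suc j) + x))"
  using x
proof (induction n)
  case 0
  then show ?case by simp
next
  case (Suc n)
  let ?w = "k + 1 - j"
  have "x + n * ?w \<le> count j" using Suc.prems by simp
  from chain_sum_remove_level[OF j this]
  have "S (rows (Suc j) + (x + Suc n * ?w)) =
      rows (Suc j) + (x + Suc n * ?w) + S (rows (Suc j) + (x + n * ?w))"
    by (simp only: mult_Suc ac_simps)
  then have "int (S (rows (Suc j) + (x + Suc n * ?w))) - int (rows (Suc j) + (x + Suc n * ?w))
      = int (S (rows (Suc j) + (x + n * ?w)))"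
    by (simp only: of_nat_add)
  also have "\<dots> = int (rows (Suc j) + (x + n * ?w)) + int (n * (rows (Suc j) + x) + ?w * (n choose 2))
      + (int (S (rows (Suc j) + x)) - int (rows (Suc j) + x))"
    using Suc by simp
  also have "\<dots> = int (Suc n * (rows (Suc j) + x) + ?w * (Suc n choose 2))
      + (int (S (rows (Suc j) + x)) - int (rows (Suc j) + x))"
    by (simp add: numeral_2_eq_2 algebra_simps)
  finally show ?case .
qed

section \<open>Removing the levels block by block\<close>

lemma diagonal_division: "count i = r i i + q i i * (k + 1 - i)"
  by (subst residue_table.simps) (simp add: quotient_table_def mod_div_mult_eq)

lemma superdiagonal_division:
  "i \<le> j \<Longrightarrow> count (Suc j) + r i j = r i (Suc j) + q i (Suc j) * (k + 1 - Suc j)"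
  by (subst (2) residue_table.simps) (simp add: quotient_table_def mod_div_mult_eq)

lemma residue_less: "i \<le> j \<Longrightarrow> j \<le> k \<Longrightarrow> r i j < k + 1 - j"
  by (subst residue_table.simps) simp

lemma excess_up_to_block:
  assumes i: "1 \<le> i" and "i \<le> j" "j \<le> k"
  shows "int (S (rows i)) - int (rows i) =
    int (\<Sum>h = i..j. q i h * (rows (Suc h) + r i h) + (k + 1 - h) * (q i h choose 2))
    + (int (S (rows (Suc j) + r i j)) - int (rows (Suc j) + r i j))"
  using \<open>i \<le> j\<close> \<open>j \<le> k\<close>
proof (induction j rule: dec_induct)
  case base
  have "rows i = rows (Suc i) + (r i i + q i i * (k + 1 - i))"
    using column_length_rec[of lam i] diagonal_division[of i] by simp
  with chain_sum_remove_levels[of i "r i i" "q i i"] diagonal_division[of i] i base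
  show ?case by simp
next
  case (step j)
  have "rows (Suc j) + r i j =
      rows (Suc (Suc j)) + (r i (Suc j) + q i (Suc j) * (k + 1 - Suc j))"
    using column_length_rec[of lam "Suc j"] superdiagonal_division[of i j] step.hyps by simp
  \<comment> \<open>The left side is \<open>count (Suc j) + r i j\<close>, and the carry
    \<open>r i j\<close> is less than \<open>k + 1 - j\<close>, so it fits into the slack.\<close>
  moreover have "r i (Suc j) + q i (Suc j) * (k + 1 - Suc j) \<le> count (Suc j) + (k + 1 - Suc j)"
    using superdiagonal_division[of i j] residue_less[of i j] step.hyps step.prems by simp
  ultimately have
    "int (S (rows (Suc j) + r i j)) - int (rows (Suc j) + r i j)
    = int (q i (Suc j) * (rows (Suc (Suc j)) + r i (Suc j)) + (k + 1 - Suc j) * (q i (Suc j) choose 2))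
      + (int (S (rows (Suc (Suc j)) + r i (Suc j))) - int (rows (Suc (Suc j)) + r i (Suc j)))"
    using chain_sum_remove_levels[of "Suc j" "r i (Suc j)" "q i (Suc j)"] step.prems by simp
  then show ?case using step by (simp add: sum.nat_ivl_Suc')
qed

text \<open>After block \<open>k\<close> nothing remains: a residue modulo 1 is 0, and no part
  exceeds \<open>k\<close>.\<close>

lemma excess:
  assumes "1 \<le> i" "i \<le> k"
  shows "int (S (rows i)) - int (rows i) =
    int (\<Sum>j = i..k. q i j * (rows (Suc j) + r i j) + (k + 1 - j) * (q i j choose 2))"
proof -
  have "r i k = 0" using residue_less[of i k] assms by simp
  moreover have "rows (Suc k) = 0" using column_length_eq_sum[OF parts_le, of "Suc k"] by simp
  ultimately show ?thesis
    using excess_up_to_block[of i k] assms by (simp add: chain_sum_def)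
qed

section \<open>Replacing binomials by products of quotients\<close>

lemma quotient_cases:
  assumes "i \<le> j" "j \<le> k"
  shows "q i j = q j j \<or> q i j = Suc (q j j)"
proof (cases "i = j")
  case False
  then obtain l where l: "j = Suc l" "i \<le> l" using assms by (cases j) auto
  let ?w = "k + 1 - j"
  have q: "q i j = (count j + r i l) div ?w" and qj: "q j j = count j div ?w"
    using l by (auto simp: quotient_table_def)
  \<comment> \<open>The carry is at most one divisor, so it raises the quotient by at most
    one.\<close>
  have "r i l \<le> ?w" using residue_less[of i l] l assms by simp
  then have "q i j \<le> (count j + ?w) div ?w" unfolding q by (intro div_le_mono) simp
  also have "\<dots> = Suc (q j j)" unfolding qj using assms by (subst div_add_self2) auto
  finally have "q i j \<le> Suc (q j j)" .
  moreover have "q j j \<le> q i j" unfolding q qj by (intro div_le_mono) simp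
  ultimately show ?thesis by linarith
qed simp

text \<open>This trades the binomial in \<open>q i j\<close> for a product and a correction
  depending on \<open>j\<close> only. It is checked for the two possible values of
  \<open>q i j\<close>.\<close>

lemma quotient_product:
  assumes "i \<le> j" "j \<le> k"
  shows "q i j * q j j = (q i j choose 2) + ((q j j + 1) choose 2)"
proof -
  have "n * n = (n choose 2) + (Suc n choose 2)" for n
    by (induction n) (simp_all add: numeral_2_eq_2)
  moreover have "Suc n * n = 2 * (Suc n choose 2)" for n
    by (induction n) (simp_all add: numeral_2_eq_2)
  ultimately show ?thesis using quotient_cases[OF assms] by auto
qed

lemma rows_Suc: "rows (Suc j) = (\<Sum>h = j + 1..k. r h h) + (\<Sum>h = j + 1..k. (k + 1 - h) * q h h)"
  by (simp add: column_length_eq_sum[OF parts_le] diagonal_division sum.distrib mult.commute)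

text \<open>The \<open>h = j\<close> term of the last sum comes from
  \<open>quotient_product\<close>, the terms with \<open>h > j\<close> from \<open>rows_Suc\<close>.
  The correction stands on the left so that no natural number subtraction of terms occurs.\<close>

lemma excess_entry:
  assumes "i \<le> j" "j \<le> k"
  shows "q i j * (rows (Suc j) + r i j) + (k + 1 - j) * (q i j choose 2)
      + (k + 1 - j) * ((q j j + 1) choose 2)
    = r i j * q i j + (\<Sum>h = j + 1..k. r h h * q i j) + (\<Sum>h = j..k. (k + 1 - h) * q h h * q i j)"
proof -
  have "(\<Sum>h = j..k. (k + 1 - h) * q h h * q i j) =
      (k + 1 - j) * q j j * q i j + (\<Sum>h = j + 1..k. (k + 1 - h) * q h h) * q i j"
    using assms by (simp add: sum.atLeast_Suc_atMost sum_distrib_right)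
  also have "(k + 1 - j) * q j j * q i j = (k + 1 - j) * (q i j * q j j)"
    by (simp only: ac_simps)
  finally show ?thesis
    unfolding quotient_product[OF assms] rows_Suc sum_distrib_right[symmetric]
    by (simp only: distrib_left distrib_right ac_simps)
qed

end

text \<open>Column \<open>j\<close> of the triangle has \<open>j\<close> entries; this is the origin
  of the factor \<open>i\<close> in the subtracted sum of the theorem.\<close>

lemma sum_upper_triangle_const:
  fixes f :: "nat \<Rightarrow> nat"
  shows "(\<Sum>i = 1..k. \<Sum>j = i..k. f j) = (\<Sum>j = 1..k. j * f j)"
proof (induction k)
  case (Suc k)
  have "(\<Sum>i = 1..k. \<Sum>j = i..Suc k. f j) = (\<Sum>i = 1..k. (\<Sum>j = i..k. f j) + f (Suc k))"
    by (rule sum.cong) auto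
  then show ?case using Suc by (simp add: sum.distrib)
qed simp

theorem theorem4p6:
  fixes k :: nat and lam :: "nat list" and r q :: "nat \<Rightarrow> nat \<Rightarrow> nat"
  assumes "1 \<le> k"
    and "bounded_partition k lam"
  defines "r \<equiv> residue_table k lam"
    and "q \<equiv> quotient_table k lam"
  shows "int (sum_list (core_of k lam)) - int (sum_list lam) =
      int (\<Sum>i = 1..k. \<Sum>j = i..k. r i j * q i j)
    + int (\<Sum>i = 1..k. \<Sum>j = i..k. \<Sum>h = j + 1..k. r h h * q i j)
    + int (\<Sum>i = 1..k. \<Sum>j = i..k. \<Sum>h = j..k. (k + 1 - h) * q h h * q i j)
    - int (\<Sum>i = 1..k. i * (k + 1 - i) * ((q i i + 1) choose 2))"
proof -
  interpret bounded_parts k lam by unfold_locales fact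
  let ?g = "\<lambda>i j. q i j * (rows (Suc j) + r i j) + (k + 1 - j) * (q i j choose 2)"
  let ?c = "\<lambda>j. (k + 1 - j) * ((q j j + 1) choose 2)"
  have "int (sum_list (core_of k lam)) - int (sum_list lam) =
      (\<Sum>i = 1..k. int (S (rows i)) - int (rows i))"
    by (simp add: sum_core sum_column_length[OF parts_le] sum_subtractf)
  also have "\<dots> = int (\<Sum>i = 1..k. \<Sum>j = i..k. ?g i j)"
    unfolding r_def q_def of_nat_sum[of _ "{1..k}"]
    by (rule sum.cong) (simp_all only: atLeastAtMost_iff excess)
  finally have lhs: "int (sum_list (core_of k lam)) - int (sum_list lam) =
      int (\<Sum>i = 1..k. \<Sum>j = i..k. ?g i j)" .
  have "(\<Sum>i = 1..k. \<Sum>j = i..k. ?g i j) + (\<Sum>i = 1..k. i * (k + 1 - i) * ((q i i + 1) choose 2))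
      = (\<Sum>i = 1..k. \<Sum>j = i..k. ?g i j + ?c j)"
    using sum_upper_triangle_const[of ?c k] by (simp add: sum.distrib mult.assoc)
  also have "\<dots> = (\<Sum>i = 1..k. \<Sum>j = i..k. r i j * q i j + (\<Sum>h = j + 1..k. r h h * q i j)
      + (\<Sum>h = j..k. (k + 1 - h) * q h h * q i j))"
    unfolding r_def q_def by (intro sum.cong refl excess_entry) auto
  also have "\<dots> = (\<Sum>i = 1..k. \<Sum>j = i..k. r i j * q i j)
      + (\<Sum>i = 1..k. \<Sum>j = i..k. \<Sum>h = j + 1..k. r h h * q i j)
      + (\<Sum>i = 1..k. \<Sum>j = i..k. \<Sum>h = j..k. (k + 1 - h) * q h h * q i j)"
    by (simp only: sum.distrib)
  finally show ?thesis unfolding lhs by linarith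
qed

end
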